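(* Let $Z_n$ be the size of the $n$th generation of a Galton--Watson tree (started from $Z_0=1$), with $\mathbf{P}[Z_1>0]>0$, and suppose that $Z_1^>$ is D-IFR. Then, for all $n\ge 1$, $Z_n^*\preceq Z_n^>$, where $Z_n^*$ has the $(\alpha,\beta)$-generalized equilibrium distribution of $Z_n$ with $\alpha=\beta=1$. Moreover, with $m(n)=\mathbf{E}[Z_n\mid Z_n>0]$, for all $t>0$, $$\mathbf{P}[Z_n\ge t\,m(n)\mid Z_n>0]\le e^{1-t}\qquad\text{and}\qquad \mathbf{P}[Z_n\le t\,m(n)\mid Z_n>0]\le t.$$
   Context: For a random variable $X$, $X^>$ denotes a random variable whose law is the conditional distribution of $X$ given $X>0$. A random variable $X$ taking values in the positive integers is D-IFR (discrete increasing failure rate) if $\mathbf{P}[X=k\mid X\ge k]$ is (weakly) increasing in $k$ for $k\ge1$ (over those $k$ with $\mathbf{P}[X\ge k]>0$). For a nonnegative random variable $X$ with $0<\mathbf{E}X<\infty$, the $(1,1)$-generalized equilibrium distribution of $X$ is the law of $VX^{s}$, where $X^{s}$ is the size-bias transform of $X$ (with law determined by $\mathbf{E}[X]\,\mathbf{E}[f(X^{s})]=\mathbf{E}[Xf(X)]$ for all bounded measurable $f$) and $V$ is uniform on $[0,1]$ and independent of $X^{s}$. $X\preceq Y$ denotes the usual stochastic order: $\mathbf{P}[X>t]\le\mathbf{P}[Y>t]$ for all $t\in\mathbb{R}$. In a Galton--Watson tree, $Z_{n+1}$ is the sum of $Z_n$ i.i.d. copies of the child distribution (the law of $Z_1$),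 independent of $Z_n$. *)

theory Defs
  imports "HOL-Probability.Probability"
begin

(* The law of Z_n, when Z_0 = 1 and the child distribution is p: given Z_n = k,
   Z_(n+1) is the sum of k independent draws from p. *)
primrec gw_size :: "nat pmf \<Rightarrow> nat \<Rightarrow> nat pmf" where
  "gw_size p 0 = return_pmf 1"
| "gw_size p (Suc n) = gw_size p n \<bind> (\<lambda>k. map_pmf sum_list (replicate_pmf k p))"

(* The law of X given X > 0; cond_pmf is unspecified when P[X > 0] = 0. *)
definition pos_part_law :: "nat pmf \<Rightarrow> nat pmf" where
  "pos_part_law q = cond_pmf q {0<..}"

(* The hazard rates are only compared where they are conditional probabilities given an
   event of positive probability: P[X \<ge> l] > 0 also gives P[X \<ge> k] > 0 for k \<le> l. *)
definition D_IFR :: "nat pmf \<Rightarrow> bool" where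
  "D_IFR q \<longleftrightarrow> set_pmf q \<subseteq> {1..} \<and>
     (\<forall>k l. 1 \<le> k \<and> k \<le> l \<and> \<P>(x in measure_pmf q. x \<ge> l) > 0 \<longrightarrow>
        \<P>(x in measure_pmf q. x = k \<bar> x \<ge> k) \<le> \<P>(x in measure_pmf q. x = l \<bar> x \<ge> l))"

definition real_law :: "nat pmf \<Rightarrow> real measure" where
  "real_law q = distr (measure_pmf q) borel real"

(* The size-bias transform of a law on [0,\<infinity>) with positive finite mean. By size_bias_iff below
   it is the law determined by E[X] E[f(X^s)] = E[X f(X)] for all bounded measurable f. *)
definition size_bias :: "real measure \<Rightarrow> real measure" where
  "size_bias M = density M (\<lambda>x. ennreal (x / (\<integral>y. y \<partial>M)))"

lemma size_bias_iff:
  fixes M N :: "real measure"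
  assumes M: "prob_space M" "sets M = sets borel" "AE x in M. 0 \<le> x"
    and int: "integrable M (\<lambda>x. x)" and pos: "(\<integral>x. x \<partial>M) > 0"
    and N: "prob_space N" "sets N = sets borel"
  shows "N = size_bias M \<longleftrightarrow>
    (\<forall>f \<in> borel_measurable borel. bounded (range f) \<longrightarrow>
       (\<integral>x. x \<partial>M) * (\<integral>x. f x \<partial>N) = (\<integral>x. x * f x \<partial>M))"
proof -
  define m where "m = (\<integral>x. x \<partial>M)"
  have m0: "m > 0" using pos by (simp add: m_def)
  interpret N: prob_space N by fact
  have [measurable_cong, simp]: "sets M = sets borel" "sets N = sets borel" by fact+
  have spM: "space M = UNIV" using sets_eq_imp_space_eq[OF M(2)] by simp
  have spN: "space N = UNIV" using sets_eq_imp_space_eq[OF N(2)] by simp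
  have sb: "(\<integral>x. f x \<partial>size_bias M) = (\<integral>x. x * f x \<partial>M) / m"
    if [measurable]: "f \<in> borel_measurable borel" for f :: "real \<Rightarrow> real"
  proof -
    have "(\<integral>x. f x \<partial>size_bias M) = (\<integral>x. (x / m) *\<^sub>R f x \<partial>M)"
      unfolding size_bias_def m_def[symmetric]
      by (rule integral_density) (use M(3) m0 in \<open>auto elim!: eventually_mono\<close>)
    also have "\<dots> = (\<integral>x. x * f x \<partial>M) / m" by simp
    finally show ?thesis .
  qed
  show ?thesis
    unfolding m_def[symmetric]
  proof (intro iffI ballI impI)
    fix f :: "real \<Rightarrow> real"
    assume eq: "N = size_bias M" and [measurable]: "f \<in> borel_measurable borel"
    show "m * (\<integral>x. f x \<partial>N) = (\<integral>x. x * f x \<partial>M)"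
      unfolding eq using sb[of f] m0 by simp
  next
    assume *: "\<forall>f \<in> borel_measurable borel. bounded (range f) \<longrightarrow>
       m * (\<integral>x. f x \<partial>N) = (\<integral>x. x * f x \<partial>M)"
    show "N = size_bias M"
    proof (rule measure_eqI)
      show "sets N = sets (size_bias M)" by (simp add: size_bias_def)
    next
      fix A assume "A \<in> sets N"
      then have A[measurable]: "A \<in> sets borel" by simp
      have "bounded (range (indicator A :: real \<Rightarrow> real))"
        by (rule boundedI[of _ 1]) (auto simp: indicator_def)
      then have 1: "m * measure N A = (\<integral>x. x * indicator A x \<partial>M)"
        using *[rule_format, of "indicator A"] by (simp add: spN)
      have "emeasure (size_bias M) A = (\<integral>\<^sup>+x. ennreal (x / m) * indicator A x \<partial>M)"
        unfolding size_bias_def m_def[symmetric] by (rule emeasure_density) auto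
      also have "\<dots> = (\<integral>\<^sup>+x. ennreal (x * indicator A x / m) \<partial>M)"
        by (intro nn_integral_cong) (auto simp: indicator_def)
      also have "\<dots> = ennreal (\<integral>x. x * indicator A x / m \<partial>M)"
      proof (rule nn_integral_eq_integral)
        show "integrable M (\<lambda>x. x * indicator A x / m)"
          using integrable_mult_indicator[OF _ int, of A] by (simp add: mult.commute)
        show "AE x in M. 0 \<le> x * indicator A x / m"
          using M(3) by eventually_elim (use m0 in \<open>auto simp: indicator_def\<close>)
      qed
      also have "\<dots> = ennreal (measure N A)"
        using 1[symmetric] m0 by simp
      finally show "emeasure N A = emeasure (size_bias M) A"
        by (simp add: N.emeasure_eq_measure)
    qed
  qed
qed

(* The law of V X^s with V uniform on [0,1] and independent of X^s. *)
definition equilibrium :: "real measure \<Rightarrow> real measure" where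
  "equilibrium M =
     distr (uniform_measure lborel {0..1} \<Otimes>\<^sub>M size_bias M) borel (\<lambda>(v, x). v * x)"

definition stoch_le :: "real measure \<Rightarrow> real measure \<Rightarrow> bool" (infix "\<preceq>" 50) where
  "M \<preceq> N \<longleftrightarrow> (\<forall>t. measure M {t<..} \<le> measure N {t<..})"

definition cond_mean :: "nat pmf \<Rightarrow> nat \<Rightarrow> real" where
  "cond_mean p n = measure_pmf.expectation (pos_part_law (gw_size p n)) real"

end

theory Submission
  imports Defs
begin

text \<open>
  Since \<open>P[V X\<^sup>s > t] = E (X - t)\<^sup>+ / E X\<close>, the stochastic comparison says that \<open>X\<^sup>>\<close> is NBUE
  (new better than used in expectation): \<open>E[X - k | X > k] \<le> E[X | X > 0]\<close> for all \<open>k\<close>. This property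
  passes from \<open>Z\<^sub>n\<close> to \<open>Z\<^sub>n\<^sub>+\<^sub>1\<close>, which is the sum of \<open>N = Z\<^sub>1\<close> independent copies of \<open>Z\<^sub>n\<close>. Let \<open>T\<^sub>k\<close> be
  the first index at which the partial sums exceed \<open>k\<close>. The excess of the sum over \<open>k\<close> is an overshoot,
  controlled by NBUE for \<open>Z\<^sub>n\<close>, plus the contribution of the remaining \<open>N - T\<^sub>k\<close> summands. As \<open>N\<^sup>>\<close> is
  D-IFR, \<open>E[N - j | N \<ge> j]\<close> decreases in \<open>j \<ge> 1\<close>; as \<open>P[T\<^sub>k = j + 1] \<ge> P[Z\<^sub>n = 0] P[T\<^sub>k = j]\<close>, with equality
  for \<open>k = 0\<close>, the law of \<open>T\<^sub>k\<close> dominates that of \<open>T\<^sub>0\<close> in likelihood ratio. So the remaining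
  contribution is largest for \<open>k = 0\<close>, by Chebyshev's sum inequality.

  For the two tail bounds, \<open>G s = E (X - s)\<^sup>+\<close> satisfies \<open>- G' s = P[X > s] \<ge> G s / m\<close>, whence
  \<open>G s \<le> G 0 exp (- s / m)\<close>, and \<open>m P[X \<ge> t m] \<le> G ((t - 1) m)\<close>; the lower tail follows from
  \<open>G s \<ge> E X - s P[X > 0]\<close>.
\<close>

section \<open>Sums of independent copies and the branching recursion\<close>

definition iid_sum :: "nat pmf \<Rightarrow> nat \<Rightarrow> nat pmf" where
  "iid_sum q k = map_pmf sum_list (replicate_pmf k q)"

text \<open>Truncated subtraction makes this the mean of the positive part of \<open>X - k\<close>,
  so \<open>excess q 0\<close> is the mean. With values in \<open>ennreal\<close>, sums and
  integrals are exchanged without convergence conditions.\<close>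

definition excess :: "nat pmf \<Rightarrow> nat \<Rightarrow> ennreal" where
  "excess q k = (\<integral>\<^sup>+z. of_nat (z - k) \<partial>measure_pmf q)"

definition tail :: "nat pmf \<Rightarrow> nat \<Rightarrow> ennreal" where
  "tail q k = emeasure (measure_pmf q) {k<..}"

text \<open>This is the NBUE property of the law conditioned to be positive, with the denominators cleared.\<close>
definition NBUE :: "nat pmf \<Rightarrow> bool" where
  "NBUE q \<longleftrightarrow> (\<forall>k. tail q 0 * excess q k \<le> excess q 0 * tail q k)"

lemma iid_sum_0: "iid_sum q 0 = return_pmf 0"
  by (simp add: iid_sum_def)

lemma iid_sum_Suc: "iid_sum q (Suc k) = q \<bind> (\<lambda>x. iid_sum q k \<bind> (\<lambda>s. return_pmf (x + s)))"
  by (simp add: iid_sum_def map_pmf_def bind_assoc_pmf bind_return_pmf)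

lemma iid_sum_Suc': "iid_sum q (Suc k) = iid_sum q k \<bind> (\<lambda>s. q \<bind> (\<lambda>x. return_pmf (s + x)))"
  unfolding iid_sum_Suc by (subst bind_commute_pmf) (simp add: add.commute)

lemma iid_sum_1: "iid_sum q (Suc 0) = q"
  by (simp add: iid_sum_Suc iid_sum_0 bind_return_pmf bind_return_pmf')

lemma iid_sum_add:
  "iid_sum q (k + l) = iid_sum q k \<bind> (\<lambda>x. iid_sum q l \<bind> (\<lambda>y. return_pmf (x + y)))"
proof (induction k)
  case 0
  then show ?case by (simp add: iid_sum_0 bind_return_pmf bind_return_pmf')
next
  case (Suc k)
  then show ?case
    by (simp add: iid_sum_Suc bind_assoc_pmf bind_return_pmf add.assoc)
qed

text \<open>The branching property: the independent draws can be regrouped by family, since draws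
  for different families commute.\<close>

lemma iid_sum_bind: "iid_sum q k \<bind> iid_sum p = iid_sum (q \<bind> iid_sum p) k"
proof (induction k)
  case 0
  then show ?case by (simp add: iid_sum_0 bind_return_pmf)
next
  case (Suc k)
  have "iid_sum q (Suc k) \<bind> iid_sum p =
      q \<bind> (\<lambda>x. iid_sum q k \<bind> (\<lambda>s. iid_sum p x \<bind> (\<lambda>u. iid_sum p s \<bind> (\<lambda>v. return_pmf (u + v)))))"
    by (simp add: iid_sum_Suc bind_assoc_pmf bind_return_pmf iid_sum_add)
  also have "\<dots> = q \<bind> (\<lambda>x. iid_sum p x \<bind> (\<lambda>u. iid_sum q k \<bind> (\<lambda>s. iid_sum p s \<bind> (\<lambda>v. return_pmf (u + v)))))"
    by (subst bind_commute_pmf) simp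
  also have "\<dots> = iid_sum (q \<bind> iid_sum p) (Suc k)"
    by (simp add: iid_sum_Suc bind_assoc_pmf flip: Suc.IH)
  finally show ?case .
qed

lemma gw_size_Suc_iid_sum: "gw_size p (Suc n) = gw_size p n \<bind> iid_sum p"
  by (simp add: iid_sum_def[abs_def])

lemma iid_sum_return_1: "iid_sum (return_pmf 1) = return_pmf"
proof
  show "iid_sum (return_pmf 1) k = return_pmf k" for k
    by (induction k) (simp_all add: iid_sum_0 iid_sum_Suc bind_return_pmf)
qed

lemma gw_size_1: "gw_size p (Suc 0) = p"
  unfolding gw_size_Suc_iid_sum by (simp add: bind_return_pmf iid_sum_1)

text \<open>Splitting at the first generation instead of the last keeps the D-IFR child law as the
  law of the number of summands at every stage.\<close>

lemma gw_size_Suc_first: "gw_size p (Suc n) = p \<bind> iid_sum (gw_size p n)"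
proof (induction n)
  case 0
  show ?case
    unfolding gw_size_1 gw_size.simps(1) iid_sum_return_1 by (simp add: bind_return_pmf')
next
  case (Suc n)
  have "gw_size p (Suc (Suc n)) = p \<bind> (\<lambda>k. iid_sum (gw_size p n) k \<bind> iid_sum p)"
    by (subst gw_size_Suc_iid_sum, subst Suc) (simp add: bind_assoc_pmf)
  also have "\<dots> = p \<bind> iid_sum (gw_size p (Suc n))"
    by (simp only: iid_sum_bind gw_size_Suc_iid_sum)
  finally show ?case .
qed

section \<open>Double series and tail-sum formulas\<close>

lemma ennreal_suminf_swap:
  fixes f :: "nat \<Rightarrow> nat \<Rightarrow> ennreal"
  shows "(\<Sum>i. \<Sum>j. f i j) = (\<Sum>j. \<Sum>i. f i j)"
  using nn_integral_suminf[of f "count_space UNIV"] by (simp add: nn_integral_count_space_nat)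

text \<open>Twice a double series is the series of its symmetrized terms, and the factor 2 is finite
  and cancels.\<close>

lemma ennreal_suminf_symmetrize:
  fixes a b :: "nat \<Rightarrow> nat \<Rightarrow> ennreal"
  assumes "\<And>i j. i \<le> j \<Longrightarrow> a i j + a j i \<le> b i j + b j i"
  shows "(\<Sum>i. \<Sum>j. a i j) \<le> (\<Sum>i. \<Sum>j. b i j)"
proof -
  have sym: "2 * (\<Sum>i. \<Sum>j. c i j) = (\<Sum>i. \<Sum>j. c i j + c j i)" for c :: "nat \<Rightarrow> nat \<Rightarrow> ennreal"
    using ennreal_suminf_swap[of c] by (simp add: suminf_add[symmetric] mult_2)
  have "a i j + a j i \<le> b i j + b j i" for i j
    using assms[of i j] assms[of j i] by (cases "i \<le> j") (auto simp: add.commute)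
  then have "2 * (\<Sum>i. \<Sum>j. a i j) \<le> 2 * (\<Sum>i. \<Sum>j. b i j)"
    unfolding sym by (intro suminf_le) auto
  then show ?thesis
    by (subst (asm) ennreal_mult_le_mult_iff) auto
qed

text \<open>Formally \<open>(Q - P) * (V - U) \<ge> 0\<close>, stated without the subtraction of
  \<open>ennreal\<close>, which is ill-behaved.\<close>

lemma ennreal_rearrange:
  fixes P Q U V :: ennreal
  assumes "P \<le> Q" "U \<le> V"
  shows "P * V + Q * U \<le> Q * V + P * U"
proof -
  obtain e where e: "Q = P + e" using assms(1) le_iff_add by auto
  have "e * U \<le> e * V" using assms(2) by (rule mult_left_mono) simp
  then show ?thesis unfolding e
    by (simp add: distrib_left distrib_right add.assoc add.left_commute add_left_mono)
qed

lemma nn_integral_sum_lessThan: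
  "(\<integral>\<^sup>+z. (\<Sum>i<z. f i) \<partial>measure_pmf p) = (\<Sum>i. tail p i * f i)"
proof -
  have "(\<Sum>i<z. f i) = (\<Sum>i. indicator {i<..} z * f i)" for z
    by (subst suminf_finite[of "{..<z}"]) (auto simp: indicator_def)
  then have "(\<integral>\<^sup>+z. (\<Sum>i<z. f i) \<partial>measure_pmf p) = (\<Sum>i. \<integral>\<^sup>+z. indicator {i<..} z * f i \<partial>measure_pmf p)"
    by (simp add: nn_integral_suminf)
  also have "\<dots> = (\<Sum>i. tail p i * f i)"
    by (simp add: tail_def nn_integral_multc)
  finally show ?thesis .
qed

lemma excess_eq_suminf: "excess p k = (\<Sum>i. tail p i * of_bool (k \<le> i))"
proof -
  have "of_nat (z - k) = (\<Sum>i<z. of_bool (k \<le> i) :: ennreal)" for z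
  proof -
    have "{..<z} \<inter> {i. k \<le> i} = {k..<z}" by auto
    then show ?thesis by simp
  qed
  then show ?thesis
    unfolding excess_def by (simp only: nn_integral_sum_lessThan)
qed

lemma excess_eq_suminf_shift: "excess p k = (\<Sum>i. tail p (k + i))"
proof -
  have "of_nat (z - k) = (\<Sum>i. indicator {k + i<..} z :: ennreal)" for z
  proof -
    have "{..<z - k} \<inter> {i. k + i < z} = {..<z - k}" by auto
    then show ?thesis
      by (subst suminf_finite[of "{..<z - k}"]) (auto simp: indicator_def)
  qed
  then have "excess p k = (\<Sum>i. \<integral>\<^sup>+z. indicator {k + i<..} z \<partial>measure_pmf p)"
    by (simp add: excess_def nn_integral_suminf)
  then show ?thesis by (simp add: tail_def)
qed

text \<open>When \<open>f\<close> holds first-passage probabilities, the right side is the expected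
  number of summands after the passage.\<close>

lemma suminf_tail_partial_sums:
  "(\<Sum>j. tail p j * (\<Sum>i<j. f i)) = (\<Sum>i. f i * excess p (Suc i))"
proof -
  have "(\<Sum>i<j. f i) = (\<Sum>i. f i * of_bool (Suc i \<le> j))" for j
    by (subst suminf_finite[of "{..<j}"]) (auto intro: sum.cong)
  then have "(\<Sum>j. tail p j * (\<Sum>i<j. f i)) = (\<Sum>j. \<Sum>i. f i * (tail p j * of_bool (Suc i \<le> j)))"
    by (simp add: ennreal_suminf_cmult[symmetric] mult_ac)
  also have "\<dots> = (\<Sum>i. f i * excess p (Suc i))"
    by (subst ennreal_suminf_swap) (simp add: excess_eq_suminf ennreal_suminf_cmult)
  finally show ?thesis .
qed

lemma return_NBUE: "NBUE (return_pmf 1)"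
  by (auto simp: NBUE_def tail_def excess_def nn_integral_return indicator_def)

lemma tail_bind: "tail (M \<bind> N) k = (\<integral>\<^sup>+x. tail (N x) k \<partial>measure_pmf M)"
  by (simp add: tail_def emeasure_bind_pmf)

lemma excess_bind: "excess (M \<bind> N) k = (\<integral>\<^sup>+x. excess (N x) k \<partial>measure_pmf M)"
  by (simp add: excess_def)

lemma tail_return: "tail (return_pmf x) k = indicator {k<..} x"
  by (simp add: tail_def)

lemma excess_return: "excess (return_pmf x) k = of_nat (x - k)"
  by (simp add: excess_def)

lemma emeasure_zero_plus_tail: "emeasure (measure_pmf q) {0} + tail q 0 = 1"
proof -
  have "{0} \<union> {0<..} = (UNIV :: nat set)" by auto
  then show ?thesis
    unfolding tail_def using measure_pmf.emeasure_space_1[of q]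
    by (subst plus_emeasure) auto
qed

section \<open>First passage of the partial sums above a level\<close>

text \<open>\<open>crossing q k i\<close> is the probability that the partial sums first exceed \<open>k\<close> at step \<open>i + 1\<close>.\<close>
definition crossing :: "nat pmf \<Rightarrow> nat \<Rightarrow> nat \<Rightarrow> ennreal" where
  "crossing q k i = (\<integral>\<^sup>+s. of_bool (s \<le> k) * tail q (k - s) \<partial>measure_pmf (iid_sum q i))"

text \<open>The mean excess over \<open>k\<close> after step \<open>i + 1\<close>, on the event that
  the first \<open>i\<close> summands do not yet exceed \<open>k\<close>.\<close>

definition overshoot :: "nat pmf \<Rightarrow> nat \<Rightarrow> nat \<Rightarrow> ennreal" where
  "overshoot q k i = (\<integral>\<^sup>+s. of_bool (s \<le> k) * excess q (k - s) \<partial>measure_pmf (iid_sum q i))"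

definition null :: "nat pmf \<Rightarrow> nat \<Rightarrow> ennreal" where
  "null q i = emeasure (measure_pmf (iid_sum q i)) {0}"

text \<open>Partial sums never decrease, so a level once exceeded stays exceeded.\<close>

lemma tail_iid_sum_Suc: "tail (iid_sum q (Suc i)) k = tail (iid_sum q i) k + crossing q k i"
proof -
  have "(\<integral>\<^sup>+x. indicator {k<..} (s + x) \<partial>measure_pmf q) =
      indicator {k<..} s + of_bool (s \<le> k) * tail q (k - s)" for s
  proof (cases "s \<le> k")
    case True
    then have "indicator {k<..} (s + x) = (indicator {k - s<..} x :: ennreal)" for x
      by (auto simp: indicator_def)
    then show ?thesis using True by (simp add: tail_def)
  next
    case False
    then show ?thesis by (simp add: measure_pmf.emeasure_space_1)
  qed
  then have "tail (iid_sum q (Suc i)) k =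
      (\<integral>\<^sup>+s. indicator {k<..} s + of_bool (s \<le> k) * tail q (k - s) \<partial>measure_pmf (iid_sum q i))"
    by (simp add: iid_sum_Suc' tail_bind tail_return)
  then show ?thesis
    by (simp add: nn_integral_add crossing_def tail_def)
qed

lemma tail_iid_sum: "tail (iid_sum q n) k = (\<Sum>i<n. crossing q k i)"
  by (induction n) (simp_all add: iid_sum_0 tail_return tail_iid_sum_Suc)

text \<open>Beyond the level, a further summand contributes its full mean; up to the level, only its
  overshoot counts.\<close>

lemma excess_iid_sum_Suc:
  "excess (iid_sum q (Suc i)) k =
     excess (iid_sum q i) k + excess q 0 * tail (iid_sum q i) k + overshoot q k i"
proof -
  have "(\<integral>\<^sup>+x. of_nat (s + x - k) \<partial>measure_pmf q) =
      of_nat (s - k) + excess q 0 * indicator {k<..} s + of_bool (s \<le> k) * excess q (k - s)" for s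
  proof (cases "s \<le> k")
    case True
    then have "s + x - k = x - (k - s)" for x by auto
    then show ?thesis using True by (simp add: excess_def)
  next
    case False
    then have "of_nat (s + x - k) = (of_nat (s - k) + of_nat x :: ennreal)" for x
      by (simp flip: of_nat_add)
    then show ?thesis using False by (simp add: nn_integral_add excess_def)
  qed
  then have "excess (iid_sum q (Suc i)) k =
      (\<integral>\<^sup>+s. of_nat (s - k) + excess q 0 * indicator {k<..} s + of_bool (s \<le> k) * excess q (k - s)
        \<partial>measure_pmf (iid_sum q i))"
    by (simp add: iid_sum_Suc' excess_bind excess_return)
  also have "\<dots> = excess (iid_sum q i) k + excess q 0 * tail (iid_sum q i) k + overshoot q k i"
    by (simp add: nn_integral_add nn_integral_cmult overshoot_def excess_def tail_def)
  finally show ?thesis .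
qed

lemma mean_iid_sum: "excess (iid_sum q n) 0 = of_nat n * excess q 0"
proof (induction n)
  case 0
  then show ?case by (simp add: iid_sum_0 excess_return)
next
  case (Suc n)
  have "(\<integral>\<^sup>+x. of_nat (s + x) \<partial>measure_pmf q) = of_nat s + excess q 0" for s
    by (simp add: nn_integral_add excess_def)
  then have "excess (iid_sum q (Suc n)) 0 = excess (iid_sum q n) 0 + excess q 0"
    by (simp add: iid_sum_Suc' excess_bind excess_return nn_integral_add) (simp add: excess_def)
  then show ?case using Suc by (simp add: distrib_right add.commute)
qed

lemma overshoot_le:
  assumes "NBUE q"
  shows "tail q 0 * overshoot q k i \<le> excess q 0 * crossing q k i"
proof -
  have "tail q 0 * (of_bool (s \<le> k) * excess q (k - s)) \<le>
      excess q 0 * (of_bool (s \<le> k) * tail q (k - s))" for s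
    using assms by (simp add: NBUE_def)
  then show ?thesis
    unfolding overshoot_def crossing_def
    by (simp add: nn_integral_cmult[symmetric] nn_integral_mono)
qed

text \<open>The \<open>crossing\<close> terms pay for the overshoot, by NBUE at the remaining level;
  the \<open>tail\<close> terms pay for the summands after the crossing.\<close>

lemma excess_iid_sum_le:
  assumes "NBUE q"
  shows "tail q 0 * excess (iid_sum q n) k \<le>
    excess q 0 * (\<Sum>i<n. crossing q k i + tail q 0 * tail (iid_sum q i) k)"
proof (induction n)
  case 0
  then show ?case by (simp add: iid_sum_0 excess_return)
next
  case (Suc n)
  show ?case
    using add_mono[OF Suc overshoot_le[OF assms, of k n]]
    by (simp add: excess_iid_sum_Suc distrib_left mult.left_commute add_ac)
qed

lemma null_0: "null q 0 = 1"
  by (simp add: null_def iid_sum_0)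

lemma null_Suc: "null q (Suc i) = null q 1 * null q i"
proof -
  have "(\<integral>\<^sup>+s. indicator {0} (x + s) \<partial>measure_pmf (iid_sum q i)) = indicator {0} x * null q i" for x
    by (simp add: null_def indicator_def)
      (auto simp: nn_integral_indicator[symmetric] simp del: nn_integral_indicator intro!: nn_integral_cong)
  then have "null q (Suc i) = (\<integral>\<^sup>+x. indicator {0} x * null q i \<partial>measure_pmf q)"
    by (simp add: null_def iid_sum_Suc emeasure_bind_pmf)
  then show ?thesis
    by (simp add: nn_integral_multc null_def iid_sum_1)
qed

lemma crossing_zero: "crossing q 0 i = tail q 0 * null q i"
proof -
  have "of_bool (s \<le> 0) * tail q (0 - s) = tail q 0 * indicator {0} s" for s :: nat
    by (auto simp: indicator_def)
  then show ?thesis by (simp add: crossing_def null_def nn_integral_cmult)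
qed

text \<open>Condition on the first summand being zero.\<close>
lemma crossing_Suc_ge: "null q 1 * crossing q k i \<le> crossing q k (Suc i)"
proof -
  have "null q 1 * crossing q k i = (\<integral>\<^sup>+x. indicator {0} x * crossing q k i \<partial>measure_pmf q)"
    by (simp add: nn_integral_multc null_def iid_sum_1)
  also have "\<dots> \<le> (\<integral>\<^sup>+x. (\<integral>\<^sup>+s. of_bool (x + s \<le> k) * tail q (k - (x + s)) \<partial>measure_pmf (iid_sum q i)) \<partial>measure_pmf q)"
    by (intro nn_integral_mono) (auto simp: indicator_def crossing_def)
  also have "\<dots> = crossing q k (Suc i)"
    by (simp add: crossing_def iid_sum_Suc)
  finally show ?thesis .
qed

text \<open>One step multiplies \<open>null\<close> by exactly \<open>null q 1\<close> and
  \<open>crossing\<close> by at least that factor. The ratio is cross-multiplied to allow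
  zeros.\<close>

lemma crossing_null_ratio:
  assumes "i \<le> j"
  shows "crossing q k i * null q j \<le> crossing q k j * null q i"
  using assms
proof (induction j rule: dec_induct)
  case base
  then show ?case by simp
next
  case (step j)
  have "crossing q k i * null q (Suc j) = null q 1 * (crossing q k i * null q j)"
    by (subst null_Suc) (simp add: mult_ac)
  also have "\<dots> \<le> null q 1 * (crossing q k j * null q i)"
    using step.IH by (rule mult_left_mono) simp
  also have "\<dots> \<le> crossing q k (Suc j) * null q i"
    unfolding mult.assoc[symmetric] by (rule mult_right_mono[OF crossing_Suc_ge]) simp
  finally show ?case .
qed

section \<open>Preservation of NBUE under random sums\<close>

text \<open>Decreasing mean residual life \<open>E[X - j | X \<ge> j]\<close>, for \<open>j = i + 1 \<ge> 1\<close> only.\<close>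
definition DMRL :: "nat pmf \<Rightarrow> bool" where
  "DMRL p \<longleftrightarrow> (\<forall>i j. i \<le> j \<longrightarrow> excess p (Suc j) * tail p i \<le> excess p (Suc i) * tail p j)"

text \<open>Chebyshev's inequality with weights \<open>tail p i * null q i\<close>: the ratio of
  \<open>crossing\<close> to \<open>null\<close> increases in \<open>i\<close>, while that of
  \<open>excess p (Suc i)\<close> to \<open>tail p i\<close> decreases.\<close>

lemma crossing_Chebyshev:
  assumes "DMRL p"
  shows "(\<Sum>i. tail p i * null q i) * (\<Sum>i. crossing q k i * excess p (Suc i)) \<le>
    (\<Sum>i. null q i * excess p (Suc i)) * (\<Sum>i. tail p i * crossing q k i)"
proof -
  have "(\<Sum>i. \<Sum>j. (crossing q k i * excess p (Suc i)) * (tail p j * null q j)) \<le>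
      (\<Sum>i. \<Sum>j. (null q i * excess p (Suc i)) * (tail p j * crossing q k j))"
  proof (rule ennreal_suminf_symmetrize)
    fix i j :: nat assume ij: "i \<le> j"
    from ennreal_rearrange[OF crossing_null_ratio[OF ij] assms[unfolded DMRL_def, rule_format, OF ij], of q k]
    show "crossing q k i * excess p (Suc i) * (tail p j * null q j) +
        crossing q k j * excess p (Suc j) * (tail p i * null q i)
      \<le> null q i * excess p (Suc i) * (tail p j * crossing q k j) +
        null q j * excess p (Suc j) * (tail p i * crossing q k i)"
      by (simp add: mult_ac)
  qed
  then show ?thesis
    by (simp add: mult.commute)
qed

lemma tail_random_sum: "tail (p \<bind> iid_sum q) k = (\<Sum>i. tail p i * crossing q k i)"
  by (simp add: tail_bind tail_iid_sum nn_integral_sum_lessThan)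

lemma mean_random_sum: "excess (p \<bind> iid_sum q) 0 = excess p 0 * excess q 0"
  by (simp add: excess_bind mean_iid_sum nn_integral_multc) (simp add: excess_def)

lemma NBUE_random_sum:
  assumes p: "DMRL p" and q: "NBUE q"
  shows "NBUE (p \<bind> iid_sum q)"
  unfolding NBUE_def
proof
  fix k
  \<comment> \<open>Let N have law \<open>p\<close> and let J(k) be the first index whose partial
    sum exceeds \<open>k\<close>. Then \<open>T0\<close> is the mean of min(N, J(0)), and
    \<open>Tk\<close> is the probability that the random sum exceeds \<open>k\<close>. The means of
    the positive parts of N - J(0) and N - J(k) are \<open>tail q 0 * B0\<close> and
    \<open>Bk\<close>.\<close>
  define T0 where "T0 = (\<Sum>i. tail p i * null q i)"
  define Tk where "Tk = (\<Sum>i. tail p i * crossing q k i)"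
  define B0 where "B0 = (\<Sum>i. null q i * excess p (Suc i))"
  define Bk where "Bk = (\<Sum>i. crossing q k i * excess p (Suc i))"
  have tail0: "tail (p \<bind> iid_sum q) 0 = tail q 0 * T0"
    by (simp add: tail_random_sum crossing_zero T0_def ennreal_suminf_cmult[symmetric] mult_ac)
  \<comment> \<open>This splits N into min(N, J(0)) and the positive part of N - J(0): the first
    \<open>i\<close> summands either all vanish or have already passed level zero.\<close>
  have mean: "excess p 0 = T0 + tail q 0 * B0"
  proof -
    have "tail p i = tail p i * null q i + tail q 0 * (tail p i * (\<Sum>j<i. null q j))" for i
    proof -
      have "1 = null q i + tail q 0 * (\<Sum>j<i. null q j)"
        using emeasure_zero_plus_tail[of "iid_sum q i"]
        by (simp add: tail_iid_sum crossing_zero null_def sum_distrib_left)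
      then have "tail p i * 1 = tail p i * (null q i + tail q 0 * (\<Sum>j<i. null q j))" by simp
      then show ?thesis by (simp add: distrib_left mult_ac)
    qed
    then have "(\<Sum>i. tail p i) = (\<Sum>i. tail p i * null q i + tail q 0 * (tail p i * (\<Sum>j<i. null q j)))"
      by (rule suminf_cong)
    then show ?thesis
      by (simp add: excess_eq_suminf suminf_add[symmetric] suminf_tail_partial_sums T0_def B0_def)
  qed
  have "tail q 0 * excess (p \<bind> iid_sum q) k = (\<integral>\<^sup>+n. tail q 0 * excess (iid_sum q n) k \<partial>measure_pmf p)"
    by (simp add: excess_bind nn_integral_cmult)
  also have "\<dots> \<le> (\<integral>\<^sup>+n. excess q 0 * (\<Sum>i<n. crossing q k i + tail q 0 * tail (iid_sum q i) k) \<partial>measure_pmf p)"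
    by (intro nn_integral_mono excess_iid_sum_le q)
  also have "\<dots> = excess q 0 * (\<Sum>i. tail p i * (crossing q k i + tail q 0 * tail (iid_sum q i) k))"
    by (simp add: nn_integral_cmult nn_integral_sum_lessThan)
  also have "(\<Sum>i. tail p i * (crossing q k i + tail q 0 * tail (iid_sum q i) k)) =
      Tk + tail q 0 * (\<Sum>i. tail p i * (\<Sum>j<i. crossing q k j))"
    by (simp add: distrib_left suminf_add[symmetric] Tk_def tail_iid_sum mult.left_commute[of _ "tail q 0"]
        del: sum_distrib_left)
  also have "\<dots> = Tk + tail q 0 * Bk"
    by (simp add: suminf_tail_partial_sums Bk_def)
  \<comment> \<open>The factor \<open>T0\<close> completes the left side of the goal, by
    \<open>tail0\<close>, and prepares the use of \<open>crossing_Chebyshev\<close>.\<close>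
  finally have "T0 * (tail q 0 * excess (p \<bind> iid_sum q) k) \<le> T0 * (excess q 0 * (Tk + tail q 0 * Bk))"
    by (rule mult_left_mono) simp
  also have "\<dots> = excess q 0 * (T0 * Tk + tail q 0 * (T0 * Bk))"
    by (simp add: distrib_left mult_ac)
  also have "\<dots> \<le> excess q 0 * (T0 * Tk + tail q 0 * (B0 * Tk))"
    using crossing_Chebyshev[OF p, of q k]
    by (intro mult_left_mono add_left_mono) (simp_all add: T0_def Tk_def B0_def Bk_def)
  also have "\<dots> = (excess p 0 * excess q 0) * Tk"
    by (simp add: mean distrib_left distrib_right mult_ac)
  finally show "tail (p \<bind> iid_sum q) 0 * excess (p \<bind> iid_sum q) k
      \<le> excess (p \<bind> iid_sum q) 0 * tail (p \<bind> iid_sum q) k"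
    unfolding tail0 mean_random_sum tail_random_sum[of p q k] Tk_def[symmetric]
    by (simp add: mult_ac)
qed

section \<open>From increasing failure rate to the generation sizes\<close>

definition survival :: "nat pmf \<Rightarrow> nat \<Rightarrow> real" where
  "survival q k = measure (measure_pmf q) {k<..}"

lemma tail_eq_survival: "tail q k = ennreal (survival q k)"
  by (simp add: tail_def survival_def measure_pmf.emeasure_eq_measure)

lemma survival_nonneg: "0 \<le> survival q k"
  by (simp add: survival_def)

lemma survival_antimono: "k \<le> l \<Longrightarrow> survival q l \<le> survival q k"
  unfolding survival_def by (rule measure_pmf.finite_measure_mono) auto

lemma survival_Suc: "survival q k = measure (measure_pmf q) {Suc k} + survival q (Suc k)"
proof -
  have "{k<..} = {Suc k} \<union> {Suc k<..}" by auto
  then show ?thesis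
    unfolding survival_def by (simp only:) (rule measure_pmf.finite_measure_Union, auto)
qed

lemma set_pmf_Int_positive:
  assumes "survival q 0 > 0"
  shows "set_pmf q \<inter> {0<..} \<noteq> {}"
  using assms measure_pmf_zero_iff[of q "{0<..}"] by (auto simp: survival_def)

lemma measure_pos_part_law:
  assumes "survival q 0 > 0"
  shows "measure (measure_pmf (pos_part_law q)) A = measure (measure_pmf q) ({0<..} \<inter> A) / survival q 0"
  using assms unfolding pos_part_law_def cond_pmf.rep_eq[OF set_pmf_Int_positive[OF assms]] survival_def
  by (subst measure_uniform_measure) (auto simp: measure_pmf.emeasure_eq_measure)

lemma hazard_pos_part_law:
  assumes "survival q 0 > 0"
  shows "\<P>(x in measure_pmf (pos_part_law q). x = Suc k \<bar> x \<ge> Suc k) =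
    (survival q k - survival q (Suc k)) / survival q k"
proof -
  have "{0<..} \<inter> {x. x = Suc k \<and> Suc k \<le> x} = {Suc k}" "{0<..} \<inter> {x. Suc k \<le> x} = {k<..}"
    by auto
  then show ?thesis
    using assms survival_Suc[of q k]
    by (simp add: cond_prob_def measure_pos_part_law) (simp add: survival_def)
qed

text \<open>The ratio of successive survival probabilities is one minus the hazard rate, hence
  decreasing; the product form also covers vanishing tails.\<close>

lemma D_IFR_survival:
  assumes pos: "survival q 0 > 0" and ifr: "D_IFR (pos_part_law q)" and "k \<le> l"
  shows "survival q (Suc l) * survival q k \<le> survival q (Suc k) * survival q l"
proof (cases "survival q l = 0")
  case True
  then show ?thesis
    using survival_antimono[of l "Suc l" q] survival_nonneg[of q "Suc l"] by simp
next
  case False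
  then have l: "survival q l > 0" using survival_nonneg[of q l] by linarith
  then have k: "survival q k > 0" using survival_antimono[OF \<open>k \<le> l\<close>, of q] by linarith
  have "{0<..} \<inter> {x. Suc l \<le> x} = {l<..}" by auto
  then have "\<P>(x in measure_pmf (pos_part_law q). x \<ge> Suc l) > 0"
    using l pos by (simp add: measure_pos_part_law) (simp add: survival_def)
  then have "\<P>(x in measure_pmf (pos_part_law q). x = Suc k \<bar> x \<ge> Suc k) \<le>
      \<P>(x in measure_pmf (pos_part_law q). x = Suc l \<bar> x \<ge> Suc l)"
    using ifr \<open>k \<le> l\<close> unfolding D_IFR_def by simp
  then have "(survival q k - survival q (Suc k)) / survival q k \<le>
      (survival q l - survival q (Suc l)) / survival q l"
    unfolding hazard_pos_part_law[OF pos] .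
  then show ?thesis
    using k l by (simp add: field_simps)
qed

lemma D_IFR_survival_add:
  assumes pos: "survival q 0 > 0" and ifr: "D_IFR (pos_part_law q)" and "k \<le> l"
  shows "survival q (l + d) * survival q k \<le> survival q (k + d) * survival q l"
proof (induction d)
  case 0
  then show ?case by simp
next
  case (Suc d)
  define a where "a = survival q (l + d)"
  define b where "b = survival q (k + d)"
  have a: "a \<ge> 0" and ab: "a \<le> b"
    using \<open>k \<le> l\<close> by (auto simp: a_def b_def survival_nonneg intro: survival_antimono)
  have a': "survival q (l + Suc d) \<le> a" unfolding a_def by (rule survival_antimono) simp
  show ?case
  proof (cases "a = 0")
    case True
    then have "survival q (l + Suc d) = 0"
      using a' survival_nonneg[of q "l + Suc d"] by linarith
    then show ?thesis by (simp add: survival_nonneg)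
  next
    case False
    with a ab have ab0: "a > 0" "b > 0" by auto
    have 1: "survival q (l + Suc d) * b \<le> survival q (k + Suc d) * a"
      using D_IFR_survival[OF pos ifr, of "k + d" "l + d"] \<open>k \<le> l\<close> by (simp add: a_def b_def)
    have 2: "a * survival q k \<le> b * survival q l" using Suc by (simp add: a_def b_def)
    \<comment> \<open>The one-step inequality is multiplied by the induction hypothesis and
      \<open>a * b\<close> is cancelled, hence the separate case \<open>a = 0\<close>.\<close>
    have "(a * b) * (survival q (l + Suc d) * survival q k) =
        (survival q (l + Suc d) * b) * (a * survival q k)" by simp
    also have "\<dots> \<le> (survival q (k + Suc d) * a) * (b * survival q l)"
      using a ab by (intro mult_mono[OF 1 2]) (simp_all add: survival_nonneg)
    also have "\<dots> = (a * b) * (survival q (k + Suc d) * survival q l)" by simp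
    finally show ?thesis using ab0 by simp
  qed
qed

text \<open>Mean excesses are sums of survival probabilities. The shift is \<open>Suc d\<close>
  because \<open>excess q (Suc j)\<close> starts with the tail at \<open>Suc j\<close>.\<close>

lemma D_IFR_imp_DMRL:
  assumes pos: "survival q 0 > 0" and ifr: "D_IFR (pos_part_law q)"
  shows "DMRL q"
  unfolding DMRL_def
proof (intro allI impI)
  fix i j :: nat assume "i \<le> j"
  have "tail q (Suc j + d) * tail q i \<le> tail q (Suc i + d) * tail q j" for d
    using D_IFR_survival_add[OF pos ifr \<open>i \<le> j\<close>, of "Suc d"]
    by (simp add: tail_eq_survival survival_nonneg ennreal_mult[symmetric] ennreal_leI)
  then have "(\<Sum>d. tail q (Suc j + d) * tail q i) \<le> (\<Sum>d. tail q (Suc i + d) * tail q j)"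
    by (intro suminf_le) auto
  then show "excess q (Suc j) * tail q i \<le> excess q (Suc i) * tail q j"
    by (simp only: excess_eq_suminf_shift ennreal_suminf_multc)
qed

text \<open>The hazard rate is bounded below from the first atom on, so the tail is geometric.\<close>
lemma D_IFR_finite_mean:
  assumes pos: "survival q 0 > 0" and ifr: "D_IFR (pos_part_law q)"
  shows "excess q 0 < \<infinity>"
proof -
  obtain K where "Suc K \<in> set_pmf q"
    using set_pmf_Int_positive[OF pos] by (auto simp: gr0_conv_Suc)
  then have "pmf q (Suc K) > 0" by (rule pmf_positive)
  then have lt: "survival q (Suc K) < survival q K"
    using survival_Suc[of q K] by (simp add: pmf.rep_eq)
  then have K: "survival q K > 0" using survival_nonneg[of q "Suc K"] by linarith
  have "summable (survival q)"
  proof (rule summable_ratio_test)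
    show "survival q (Suc K) / survival q K < 1" using lt K by simp
    show "norm (survival q (Suc n)) \<le> survival q (Suc K) / survival q K * norm (survival q n)"
      if "n \<ge> K" for n
      using D_IFR_survival[OF pos ifr that] K by (simp add: survival_nonneg field_simps)
  qed
  then have "(\<Sum>i. ennreal (survival q i)) = ennreal (\<Sum>i. survival q i)"
    by (intro suminf_ennreal2) (simp_all add: survival_nonneg)
  then show ?thesis by (simp add: excess_eq_suminf tail_eq_survival)
qed

text \<open>The child law supplies DMRL for the number of summands, and the induction hypothesis
  supplies NBUE for each summand.\<close>

lemma gw_size_NBUE:
  assumes pos: "survival p 0 > 0" and ifr: "D_IFR (pos_part_law p)"
  shows "NBUE (gw_size p n) \<and> excess (gw_size p n) 0 < \<infinity> \<and> survival (gw_size p n) 0 > 0"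
proof (induction n)
  case 0
  then show ?case
    unfolding gw_size.simps(1) using return_NBUE
    by (simp add: excess_return survival_def indicator_def)
next
  case (Suc n)
  let ?g = "gw_size p n"
  \<comment> \<open>The term \<open>i = 0\<close> alone: there is a child, and the first copy is
    positive.\<close>
  have "tail p 0 * crossing ?g 0 0 \<le> tail (p \<bind> iid_sum ?g) 0"
    unfolding tail_random_sum using sum_le_suminf[of "\<lambda>i. tail p i * crossing ?g 0 i" "{0}"] by simp
  then have "survival p 0 * survival ?g 0 \<le> survival (gw_size p (Suc n)) 0"
    unfolding gw_size_Suc_first
    by (simp add: crossing_zero null_0 tail_eq_survival ennreal_mult[symmetric] survival_nonneg)
  then have "survival (gw_size p (Suc n)) 0 > 0"
    using Suc pos mult_pos_pos[of "survival p 0" "survival ?g 0"] by linarith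
  moreover have "excess (gw_size p (Suc n)) 0 < \<infinity>"
    unfolding gw_size_Suc_first mean_random_sum using Suc D_IFR_finite_mean[OF pos ifr]
    by (simp add: ennreal_mult_less_top)
  moreover have "NBUE (gw_size p (Suc n))"
    unfolding gw_size_Suc_first using Suc D_IFR_imp_DMRL[OF pos ifr] by (intro NBUE_random_sum) auto
  ultimately show ?case by blast
qed

section \<open>The stop-loss transform and the two tail bounds\<close>

definition stop_loss :: "nat pmf \<Rightarrow> real \<Rightarrow> real" where
  "stop_loss q s = measure_pmf.expectation q (\<lambda>z. max 0 (real z - s))"

locale finite_mean_NBUE =
  fixes q :: "nat pmf"
  assumes nbue: "NBUE q" and finite_mean: "excess q 0 < \<infinity>" and pos: "survival q 0 > 0"
begin

abbreviation "mean \<equiv> measure_pmf.expectation q real"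

text \<open>The mean conditioned on positivity, as \<open>cmean_eq\<close> confirms.\<close>

definition "cmean = mean / survival q 0"

lemma integrable_real [simp]: "integrable (measure_pmf q) real"
  using finite_mean by (intro integrableI_nonneg) (auto simp: excess_def ennreal_of_nat_eq_real_of_nat)

lemma integrable_stop_loss [simp]: "integrable (measure_pmf q) (\<lambda>z. max 0 (real z - s))"
proof (rule Bochner_Integration.integrable_bound)
  show "integrable (measure_pmf q) (\<lambda>z. real z + \<bar>s\<bar>)" by simp
qed auto

lemma integrable_indicat [simp]: "integrable (measure_pmf q) (indicat_real A)"
  by (rule integrable_real_indicator) (auto simp: measure_pmf.emeasure_eq_measure)

lemma stop_loss_nonneg: "0 \<le> stop_loss q s"
  unfolding stop_loss_def by simp

lemma stop_loss_0: "stop_loss q 0 = mean"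
  by (simp add: stop_loss_def)

lemma excess_eq_stop_loss: "excess q k = ennreal (stop_loss q (real k))"
proof -
  have "excess q k = (\<integral>\<^sup>+z. ennreal (max 0 (real z - real k)) \<partial>measure_pmf q)"
    unfolding excess_def by (intro nn_integral_cong) (auto simp: ennreal_of_nat_eq_real_of_nat max_def of_nat_diff)
  also have "\<dots> = ennreal (stop_loss q (real k))"
    unfolding stop_loss_def by (rule nn_integral_eq_integral[OF integrable_stop_loss]) simp
  finally show ?thesis .
qed

lemma mean_pos: "0 < mean"
proof -
  have "survival q 0 = measure_pmf.expectation q (indicat_real {0<..})"
    by (simp add: survival_def)
  also have "\<dots> \<le> mean"
    by (rule integral_mono, simp, simp, auto simp: indicator_def)
  finally show ?thesis using pos by linarith
qed

lemma cmean_pos: "0 < cmean"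
  using mean_pos pos by (simp add: cmean_def)

lemma stop_loss_nat_le: "stop_loss q (real k) \<le> cmean * survival q k"
proof -
  have "ennreal (survival q 0 * stop_loss q (real k)) \<le> ennreal (mean * survival q k)"
    using nbue unfolding NBUE_def
    by (simp add: tail_eq_survival excess_eq_stop_loss stop_loss_0 ennreal_mult survival_nonneg stop_loss_nonneg)
  then show ?thesis
    using pos mean_pos by (simp add: cmean_def field_simps survival_nonneg)
qed

text \<open>Between consecutive integers the tail is constant and the transform decreases, so
  integer levels suffice.\<close>

lemma stop_loss_le:
  assumes "0 \<le> s"
  shows "stop_loss q s \<le> cmean * measure (measure_pmf q) {z. s < real z}"
proof -
  define k where "k = nat \<lfloor>s\<rfloor>"
  have k: "real k \<le> s" "s < real k + 1" using assms by (simp_all add: k_def)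
  have "{z. s < real z} = {k<..}"
  proof (intro set_eqI iffI; simp)
    show "k < z" if "s < real z" for z using that k by linarith
    show "s < real z" if "k < z" for z
    proof -
      have "real k + 1 \<le> real z" using that by linarith
      then show ?thesis using k by linarith
    qed
  qed
  moreover have "stop_loss q s \<le> stop_loss q (real k)"
    unfolding stop_loss_def using k by (intro integral_mono) auto
  ultimately show ?thesis
    using stop_loss_nat_le[of k] by (simp add: survival_def)
qed

text \<open>No value lies strictly between \<open>k\<close> and \<open>k + 1\<close>, so the
  transform is affine there.\<close>

lemma stop_loss_interpolate:
  assumes "0 \<le> f" "f \<le> 1"
  shows "stop_loss q (real k + f) = stop_loss q (real k) - f * survival q k"
proof -
  have "max 0 (real z - (real k + f)) = max 0 (real z - real k) - f * indicat_real {k<..} z" for z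
  proof (cases "k < z")
    case True
    then have "real k + 1 \<le> real z" by linarith
    then show ?thesis using assms True by simp
  next
    case False
    then have "real z \<le> real k" by simp
    then show ?thesis using assms False by simp
  qed
  then show ?thesis
    unfolding stop_loss_def survival_def by simp
qed

text \<open>This replaces integration of the differential inequality: the affine bound on a unit
  interval becomes exponential through 1 - x <= exp(-x).\<close>

lemma stop_loss_decay:
  assumes "0 \<le> f" "f \<le> 1"
  shows "stop_loss q (real k + f) \<le> stop_loss q (real k) * exp (- f / cmean)"
proof -
  have "f * (stop_loss q (real k) / cmean) \<le> f * survival q k"
    using stop_loss_nat_le[of k] cmean_pos assms by (intro mult_left_mono) (simp_all add: field_simps)
  then have "stop_loss q (real k + f) \<le> stop_loss q (real k) * (1 - f / cmean)"
    using stop_loss_interpolate[OF assms, of k] by (simp add: algebra_simps)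
  also have "\<dots> \<le> stop_loss q (real k) * exp (- f / cmean)"
    using exp_ge_add_one_self[of "- f / cmean"] stop_loss_nonneg[of "real k"] by (intro mult_left_mono) auto
  finally show ?thesis .
qed

lemma stop_loss_exp_le:
  assumes "0 \<le> s"
  shows "stop_loss q s \<le> mean * exp (- s / cmean)"
proof -
  have nat: "stop_loss q (real k) \<le> mean * exp (- real k / cmean)" for k
  proof (induction k)
    case 0
    then show ?case by (simp add: stop_loss_0)
  next
    case (Suc k)
    have "stop_loss q (real (Suc k)) \<le> stop_loss q (real k) * exp (- 1 / cmean)"
      using stop_loss_decay[of 1 k] by (simp add: add.commute)
    also have "\<dots> \<le> mean * exp (- real k / cmean) * exp (- 1 / cmean)"
      using Suc by (rule mult_right_mono) simp
    also have "\<dots> = mean * exp (- real k / cmean + - 1 / cmean)"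
      by (simp only: exp_add mult.assoc)
    also have "- real k / cmean + - 1 / cmean = - real (Suc k) / cmean"
      using cmean_pos by (simp add: field_simps)
    finally show ?case .
  qed
  define k where "k = nat \<lfloor>s\<rfloor>"
  have k: "real k \<le> s" "s < real k + 1" using assms by (simp_all add: k_def)
  have "stop_loss q s \<le> stop_loss q (real k) * exp (- (s - real k) / cmean)"
    using stop_loss_decay[of "s - real k" k] k by simp
  also have "\<dots> \<le> mean * exp (- real k / cmean) * exp (- (s - real k) / cmean)"
    using nat by (rule mult_right_mono) simp
  also have "\<dots> = mean * exp (- real k / cmean + - (s - real k) / cmean)"
    by (simp only: exp_add mult.assoc)
  also have "- real k / cmean + - (s - real k) / cmean = - s / cmean"
    using cmean_pos by (simp add: field_simps)
  finally show ?thesis .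
qed

lemma cond_prob_ge_le:
  assumes "t > 0"
  shows "\<P>(z in measure_pmf q. real z \<ge> t * cmean \<bar> z > 0) \<le> exp (1 - t)"
proof (cases "t \<ge> 1")
  case True
  define P where "P = measure (measure_pmf q) {z. t * cmean \<le> real z}"
  have "cmean * P = measure_pmf.expectation q (\<lambda>z. cmean * indicat_real {z. t * cmean \<le> real z} z)"
    by (simp add: P_def)
  \<comment> \<open>A Markov-type bound: where \<open>real z \<ge> t * cmean\<close>, the positive
    part of \<open>real z - (t - 1) * cmean\<close> is at least \<open>cmean\<close>.\<close>
  also have "\<dots> \<le> stop_loss q ((t - 1) * cmean)"
    unfolding stop_loss_def using cmean_pos
    by (intro integral_mono, simp, simp, auto simp: indicator_def algebra_simps)
  also have "\<dots> \<le> mean * exp (- ((t - 1) * cmean) / cmean)"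
    using True cmean_pos by (intro stop_loss_exp_le) simp
  also have "\<dots> = cmean * (survival q 0 * exp (1 - t))"
    using cmean_pos pos by (simp add: cmean_def)
  finally have "P \<le> survival q 0 * exp (1 - t)"
    using cmean_pos by simp
  moreover have "measure (measure_pmf q) {z. t * cmean \<le> real z \<and> 0 < z} \<le> P"
    unfolding P_def by (rule measure_pmf.finite_measure_mono) auto
  ultimately show ?thesis
    using pos by (simp add: cond_prob_def survival_def greaterThan_def field_simps)
next
  \<comment> \<open>Here the level \<open>(t - 1) * cmean\<close> would be negative, but the claimed
    bound exceeds 1.\<close>
  case False
  have "measure (measure_pmf q) {z. t * cmean \<le> real z \<and> 0 < z} \<le> survival q 0"
    unfolding survival_def by (rule measure_pmf.finite_measure_mono) auto
  then have "\<P>(z in measure_pmf q. real z \<ge> t * cmean \<bar> z > 0) \<le> 1"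
    using pos by (simp add: cond_prob_def survival_def greaterThan_def)
  also have "1 \<le> exp (1 - t)" using False by simp
  finally show ?thesis .
qed

lemma cond_prob_le_le:
  assumes "t > 0"
  shows "\<P>(z in measure_pmf q. real z \<le> t * cmean \<bar> z > 0) \<le> t"
proof -
  define s where "s = t * cmean"
  have s: "0 \<le> s" using assms cmean_pos by (simp add: s_def)
  define P where "P = measure (measure_pmf q) {z. s < real z}"
  have "mean - s * survival q 0 = measure_pmf.expectation q (\<lambda>z. real z - s * indicat_real {0<..} z)"
    by (subst Bochner_Integration.integral_diff) (simp_all add: survival_def)
  \<comment> \<open>Pointwise, with \<open>s\<close> subtracted only at positive \<open>z\<close>;
    at \<open>z = 0\<close> both integrands vanish.\<close>
  also have "\<dots> \<le> stop_loss q s"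
    unfolding stop_loss_def using s by (intro integral_mono, simp, simp, auto simp: indicator_def)
  also have "\<dots> \<le> cmean * P"
    unfolding P_def by (rule stop_loss_le[OF s])
  also have "mean - s * survival q 0 = cmean * (survival q 0 * (1 - t))"
    using pos by (simp add: s_def cmean_def field_simps)
  finally have "survival q 0 * (1 - t) \<le> P"
    using cmean_pos by simp
  moreover have "survival q 0 = measure (measure_pmf q) {z. real z \<le> s \<and> 0 < z} + P"
  proof -
    have eq: "{0<..} = {z. real z \<le> s \<and> 0 < z} \<union> {z. s < real z}" using s by auto
    show ?thesis
      unfolding survival_def P_def eq by (rule measure_pmf.finite_measure_Union) auto
  qed
  ultimately have "measure (measure_pmf q) {z. real z \<le> s \<and> 0 < z} \<le> t * survival q 0"
    by (simp add: algebra_simps)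
  moreover have "\<P>(z in measure_pmf q. real z \<le> s \<bar> z > 0) =
      measure (measure_pmf q) {z. real z \<le> s \<and> 0 < z} / survival q 0"
    by (simp add: cond_prob_def survival_def greaterThan_def)
  ultimately show ?thesis
    unfolding s_def[symmetric] using pos by (simp add: pos_divide_le_eq)
qed

lemma cmean_eq: "measure_pmf.expectation (pos_part_law q) real = cmean"
proof -
  have "(\<integral>\<^sup>+z. ennreal (real z) \<partial>measure_pmf (pos_part_law q)) =
      (\<integral>\<^sup>+z. ennreal (real z) * indicator {0<..} z \<partial>measure_pmf q) / tail q 0"
    unfolding pos_part_law_def cond_pmf.rep_eq[OF set_pmf_Int_positive[OF pos]] tail_def
    by (rule nn_integral_uniform_measure) auto
  also have "(\<integral>\<^sup>+z. ennreal (real z) * indicator {0<..} z \<partial>measure_pmf q) = excess q 0"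
    unfolding excess_def
    by (intro nn_integral_cong) (auto simp: indicator_def ennreal_of_nat_eq_real_of_nat)
  also have "\<dots> / tail q 0 = ennreal cmean"
    using pos mean_pos excess_eq_stop_loss[of 0] by (simp add: stop_loss_0 tail_eq_survival divide_ennreal cmean_def)
  finally show ?thesis
    using cmean_pos by (subst integral_eq_nn_integral) auto
qed

section \<open>The equilibrium law and the stochastic order\<close>

lemma mean_real_law: "(\<integral>y. y \<partial>real_law q) = mean"
  unfolding real_law_def by (simp add: integral_distr)

lemma nn_integral_size_bias:
  assumes [measurable]: "f \<in> borel_measurable borel"
  shows "(\<integral>\<^sup>+x. f x \<partial>size_bias (real_law q)) = (\<integral>\<^sup>+z. ennreal (real z / mean) * f (real z) \<partial>measure_pmf q)"
  unfolding size_bias_def mean_real_law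
  by (subst nn_integral_density) (simp_all add: real_law_def nn_integral_distr)

lemma prob_space_size_bias: "prob_space (size_bias (real_law q))"
proof
  have "emeasure (size_bias (real_law q)) (space (size_bias (real_law q))) =
      (\<integral>\<^sup>+x. 1 \<partial>size_bias (real_law q))" by simp
  also have "\<dots> = (\<integral>\<^sup>+z. ennreal (real z / mean) \<partial>measure_pmf q)"
    by (subst nn_integral_size_bias) auto
  also have "\<dots> = ennreal (measure_pmf.expectation q (\<lambda>z. real z / mean))"
    using mean_pos by (intro nn_integral_eq_integral) auto
  finally show "emeasure (size_bias (real_law q)) (space (size_bias (real_law q))) = 1"
    using mean_pos by simp
qed

text \<open>Negative \<open>y\<close> must be covered too, since \<open>size_bias\<close> yields a
  measure on the whole real line.\<close>

lemma uniform_scaled_tail: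
  assumes "0 \<le> t"
  shows "emeasure (uniform_measure lborel {0..1}) {v. t < v * y} = ennreal (if y \<le> t then 0 else 1 - t / y)"
proof -
  have [measurable]: "{v. t < v * y} \<in> sets borel" by measurable
  have "{0..1} \<inter> {v. t < v * y} = (if y \<le> t then {} else {t / y<..1})"
  proof (cases "y \<le> t")
    case True
    have "v * y \<le> t" if "0 \<le> v" "v \<le> 1" for v
    proof (cases "y \<ge> 0")
      case True
      then show ?thesis using that \<open>y \<le> t\<close> mult_right_mono[of v 1 y] by linarith
    next
      case False
      then have "v * y \<le> 0" using that by (simp add: mult_nonneg_nonpos)
      then show ?thesis using assms by linarith
    qed
    then show ?thesis using True by force
  next
    case False
    then have y: "0 < y" "t < y" using assms by auto
    have "v \<ge> 0" if "t / y < v" for v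
      using assms y that divide_nonneg_pos[of t y] by linarith
    then show ?thesis using False y by (auto simp: pos_divide_less_eq)
  qed
  moreover have "t / y \<le> 1" if "\<not> y \<le> t" using that assms by simp
  ultimately show ?thesis by (simp add: divide_ennreal flip: ennreal_1)
qed

lemma equilibrium_tail:
  assumes "0 \<le> t"
  shows "measure (equilibrium (real_law q)) {t<..} = stop_loss q t / mean"
proof -
  let ?U = "uniform_measure lborel {0..1 :: real}" and ?S = "size_bias (real_law q)"
  let ?g = "\<lambda>y :: real. ennreal (if y \<le> t then 0 else 1 - t / y)"
  interpret S: prob_space ?S by (rule prob_space_size_bias)
  interpret U: prob_space ?U by (rule prob_space_uniform_measure) auto
  interpret pair_sigma_finite ?U ?S ..
  have sets_S [measurable_cong]: "sets ?S = sets borel" by (simp add: size_bias_def real_law_def)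
  have [measurable_cong]: "sets ?U = sets borel" by simp
  have space: "space (?U \<Otimes>\<^sub>M ?S) = UNIV"
    by (simp add: space_pair_measure sets_eq_imp_space_eq[OF sets_S])
  have meas: "(\<lambda>(v, x). v * x) \<in> borel_measurable (?U \<Otimes>\<^sub>M ?S)" by measurable
  have "emeasure (equilibrium (real_law q)) {t<..} =
      emeasure (?U \<Otimes>\<^sub>M ?S) ((\<lambda>(v, x). v * x) -` {t<..} \<inter> space (?U \<Otimes>\<^sub>M ?S))"
    unfolding equilibrium_def by (rule emeasure_distr[OF meas]) simp
  also have "\<dots> = (\<integral>\<^sup>+y. emeasure ?U ((\<lambda>v. (v, y)) -` ((\<lambda>(v, x). v * x) -` {t<..} \<inter> space (?U \<Otimes>\<^sub>M ?S))) \<partial>?S)"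
    by (rule emeasure_pair_measure_alt2, rule measurable_sets[OF meas]) simp
  also have "\<dots> = (\<integral>\<^sup>+y. ?g y \<partial>?S)"
    unfolding space using uniform_scaled_tail[OF assms]
    by (intro nn_integral_cong) (simp add: vimage_def)
  also have "\<dots> = (\<integral>\<^sup>+z. ennreal (real z / mean) * ?g (real z) \<partial>measure_pmf q)"
    by (rule nn_integral_size_bias) measurable
  also have "\<dots> = (\<integral>\<^sup>+z. ennreal (max 0 (real z - t) / mean) \<partial>measure_pmf q)"
  proof (rule nn_integral_cong)
    fix z
    show "ennreal (real z / mean) * ?g (real z) = ennreal (max 0 (real z - t) / mean)"
    proof (cases "real z \<le> t")
      case False
      then have z: "0 < real z" "t < real z" using assms by linarith+
      \<comment> \<open>The size-bias factor cancels the denominator in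
        \<open>1 - t / real z\<close>, which leaves the stop-loss integrand.\<close>
      have "real z / mean * (1 - t / real z) = max 0 (real z - t) / mean"
        using z mean_pos by (simp add: field_simps)
      then show ?thesis
        using z mean_pos False by (simp add: ennreal_mult[symmetric])
    qed simp
  qed
  also have "\<dots> = ennreal (measure_pmf.expectation q (\<lambda>z. max 0 (real z - t) / mean))"
    using mean_pos by (intro nn_integral_eq_integral) auto
  also have "\<dots> = ennreal (stop_loss q t / mean)"
    by (simp add: stop_loss_def)
  finally show ?thesis
    using stop_loss_nonneg mean_pos by (simp add: measure_def)
qed

lemma real_law_pos_part_tail:
  "measure (real_law (pos_part_law q)) {t<..} =
     measure (measure_pmf q) ({0<..} \<inter> {z. t < real z}) / survival q 0"
  by (simp add: real_law_def measure_distr vimage_def measure_pos_part_law[OF pos])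

text \<open>For \<open>t \<ge> 0\<close> this is \<open>stop_loss_le\<close> divided by the mean;
  for negative \<open>t\<close> the right side equals 1.\<close>

lemma equilibrium_stoch_le: "equilibrium (real_law q) \<preceq> real_law (pos_part_law q)"
  unfolding stoch_le_def
proof
  fix t :: real
  show "measure (equilibrium (real_law q)) {t<..} \<le> measure (real_law (pos_part_law q)) {t<..}"
  proof (cases "0 \<le> t")
    case True
    then have "{0<..} \<inter> {z. t < real z} = {z. t < real z}" by auto
    then show ?thesis
      using stop_loss_le[OF True] mean_pos pos
      by (simp add: equilibrium_tail[OF True] real_law_pos_part_tail cmean_def field_simps)
  next
    case False
    then have "{0<..} \<inter> {z. t < real z} = {0<..}" by auto
    then have "measure (real_law (pos_part_law q)) {t<..} = 1"
      using pos by (simp add: real_law_pos_part_tail) (simp add: survival_def)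
    moreover interpret U: prob_space "uniform_measure lborel {0..1 :: real}"
      by (rule prob_space_uniform_measure) auto
    interpret S: prob_space "size_bias (real_law q)" by (rule prob_space_size_bias)
    interpret P: pair_prob_space "uniform_measure lborel {0..1 :: real}" "size_bias (real_law q)" ..
    have [measurable_cong]: "sets (size_bias (real_law q)) = sets borel"
      by (simp add: size_bias_def real_law_def)
    interpret E: prob_space "equilibrium (real_law q)"
      unfolding equilibrium_def by (rule P.prob_space_distr) measurable
    have "measure (equilibrium (real_law q)) {t<..} \<le> 1" by simp
    ultimately show ?thesis by simp
  qed
qed

end

theorem theorem7:
  fixes p :: "nat pmf" and n :: nat
  assumes "\<P>(z in measure_pmf (gw_size p 1). z > 0) > 0"
    and "D_IFR (pos_part_law (gw_size p 1))"
    and "n \<ge> 1"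
  shows "equilibrium (real_law (gw_size p n)) \<preceq> real_law (pos_part_law (gw_size p n)) \<and>
    (\<forall>t::real. t > 0 \<longrightarrow>
       \<P>(z in measure_pmf (gw_size p n). real z \<ge> t * cond_mean p n \<bar> z > 0) \<le> exp (1 - t) \<and>
       \<P>(z in measure_pmf (gw_size p n). real z \<le> t * cond_mean p n \<bar> z > 0) \<le> t)"
proof -
  have pos: "survival p 0 > 0" and ifr: "D_IFR (pos_part_law p)"
    using assms(1,2) by (simp_all add: gw_size_1 survival_def greaterThan_def del: gw_size.simps)
  interpret finite_mean_NBUE "gw_size p n"
    using gw_size_NBUE[OF pos ifr] by unfold_locales auto
  show ?thesis
    using equilibrium_stoch_le cond_prob_ge_le cond_prob_le_le
    unfolding cond_mean_def cmean_eq by blast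
qed

end
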